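(* Let $(M,\varphi,\xi,\eta,g)$ be a normal almost paracontact metric three-manifold. If $\xi$ is a conformal Killing vector field, then $\xi$ is Killing. In particular, if $(M,\varphi,\xi,\eta,g)$ is also an almost paracontact Ricci soliton, then it is trivial, that is, $(M,g)$ has (nonpositive) constant sectional curvature.
   Context: An almost paracontact structure on a connected smooth $3$-manifold $M$ is a triple $(\varphi,\xi,\eta)$ of a $(1,1)$-tensor, a global vector field and a $1$-form with $\varphi(\xi)=0$, $\eta\circ\varphi=0$, $\eta(\xi)=1$, $\varphi^2=\mathrm{Id}-\eta\otimes\xi$, and such that the $\pm1$-eigenbundles of $\varphi|_{\ker\eta}$ both have rank $1$. It is an almost paracontact metric structure together with a pseudo-Riemannian metric $g$ if $g(\varphi X,\varphi Y)=-g(X,Y)+\eta(X)\eta(Y)$; then $\eta=g(\xi,\cdot)$. It is normal if $[\varphi,\varphi]-2d\eta\otimes\xi=0$, where $[\varphi,\varphi]$ is the Nijenhuis torsion of $\varphi$ and $d\eta(X,Y)=\frac12\big(X\eta(Y)-Y\eta(X)-\eta([X,Y])\big)$; in dimension three this is equivalent to $\mathcal L_\xi\varphi=0$. $\xi$ is conformal Killing if $\mathcal L_\xi g=f\cdot g$ for some smooth function $f$, and Killing if $\mathcal L_\xi g=0$. The manifold is an almost paracontact Ricci soliton if $\mathcal L_\xi g+\varrho=\lambda g$ for some real constant $\lambda$, with $\varrho$ the Ricci tensor (standard sign, positive on round spheres). *)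

theory Defs
  imports "HOL-Analysis.Analysis"
begin

section \<open>Smooth maps on open subsets of Euclidean spaces\<close>

text \<open>Only meant for open \<open>S\<close>: all iterated directional derivatives exist and are continuous.\<close>

fun Ck_on :: "nat \<Rightarrow> 'e::euclidean_space set \<Rightarrow> ('e \<Rightarrow> 'f::real_normed_vector) \<Rightarrow> bool" where
  "Ck_on 0 S f \<longleftrightarrow> continuous_on S f"
| "Ck_on (Suc k) S f \<longleftrightarrow>
     f differentiable_on S \<and> (\<forall>v. Ck_on k S (\<lambda>x. frechet_derivative f (at x) v))"

definition smooth_on :: "'e::euclidean_space set \<Rightarrow> ('e \<Rightarrow> 'f::real_normed_vector) \<Rightarrow> bool" where
  "smooth_on S f \<longleftrightarrow> (\<forall>k. Ck_on k S f)"


section \<open>Smooth 3-manifolds\<close>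

text \<open>A chart is a pair of a domain and a coordinate map; the values of the map outside the
  domain are irrelevant.  The smooth structure is given by an atlas that need not be maximal.\<close>

type_synonym 'a chart = "'a set \<times> ('a \<Rightarrow> real^3)"

definition coord_dom :: "'a chart \<Rightarrow> (real^3) set" where
  "coord_dom c = snd c ` fst c"

definition coord_inv :: "'a chart \<Rightarrow> real^3 \<Rightarrow> 'a" where
  "coord_inv c = inv_into (fst c) (snd c)"

definition overlap :: "'a chart \<Rightarrow> 'a chart \<Rightarrow> (real^3) set" where
  "overlap c d = snd c ` (fst c \<inter> fst d)"

definition transition :: "'a chart \<Rightarrow> 'a chart \<Rightarrow> real^3 \<Rightarrow> real^3" where
  "transition c d = snd d \<circ> coord_inv c"

definition jac :: "'a chart \<Rightarrow> 'a chart \<Rightarrow> real^3 \<Rightarrow> real^3 \<Rightarrow> real^3" where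
  "jac c d x = frechet_derivative (transition c d) (at x)"

locale connected_smooth_3_manifold =
  fixes M :: "'a topology" and A :: "'a chart set"
  assumes Hausdorff: "Hausdorff_space M"
    and second_countable: "second_countable M"
    and connected: "connected_space M"
    and covers: "(\<Union>c\<in>A. fst c) = topspace M"
    and open_chart: "c \<in> A \<Longrightarrow> openin M (fst c)"
    and open_coord: "c \<in> A \<Longrightarrow> open (coord_dom c)"
    and homeomorphism: "c \<in> A \<Longrightarrow>
      homeomorphic_map (subtopology M (fst c)) (top_of_set (coord_dom c)) (snd c)"
    and smooth_transition: "c \<in> A \<Longrightarrow> d \<in> A \<Longrightarrow> smooth_on (overlap c d) (transition c d)"


section \<open>Tensor fields\<close>

text \<open>A tensor field is given by its representatives in the coordinates of the charts of the
  atlas, subject to the transformation law under changes of coordinates.  A representative in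
  the chart \<open>c\<close> is a function on \<open>coord_dom c\<close>; its values elsewhere are irrelevant.\<close>

definition smooth_function :: "'a chart set \<Rightarrow> ('a \<Rightarrow> real) \<Rightarrow> bool" where
  "smooth_function A f \<longleftrightarrow> (\<forall>c\<in>A. smooth_on (coord_dom c) (f \<circ> coord_inv c))"

definition vector_field :: "'a chart set \<Rightarrow> ('a chart \<Rightarrow> real^3 \<Rightarrow> real^3) \<Rightarrow> bool" where
  "vector_field A X \<longleftrightarrow>
     (\<forall>c\<in>A. smooth_on (coord_dom c) (X c)) \<and>
     (\<forall>c\<in>A. \<forall>d\<in>A. \<forall>x\<in>overlap c d. X d (transition c d x) = jac c d x (X c x))"

definition one_form :: "'a chart set \<Rightarrow> ('a chart \<Rightarrow> real^3 \<Rightarrow> real^3 \<Rightarrow> real) \<Rightarrow> bool" where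
  "one_form A \<eta> \<longleftrightarrow>
     (\<forall>c\<in>A. \<forall>x\<in>coord_dom c. linear (\<eta> c x)) \<and>
     (\<forall>c\<in>A. \<forall>u. smooth_on (coord_dom c) (\<lambda>x. \<eta> c x u)) \<and>
     (\<forall>c\<in>A. \<forall>d\<in>A. \<forall>x\<in>overlap c d. \<forall>u. \<eta> d (transition c d x) (jac c d x u) = \<eta> c x u)"

definition tensor_11 :: "'a chart set \<Rightarrow> ('a chart \<Rightarrow> real^3 \<Rightarrow> real^3 \<Rightarrow> real^3) \<Rightarrow> bool" where
  "tensor_11 A \<phi> \<longleftrightarrow>
     (\<forall>c\<in>A. \<forall>x\<in>coord_dom c. linear (\<phi> c x)) \<and>
     (\<forall>c\<in>A. \<forall>u. smooth_on (coord_dom c) (\<lambda>x. \<phi> c x u)) \<and>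
     (\<forall>c\<in>A. \<forall>d\<in>A. \<forall>x\<in>overlap c d. \<forall>u.
        \<phi> d (transition c d x) (jac c d x u) = jac c d x (\<phi> c x u))"

definition pseudo_Riemannian_metric ::
  "'a chart set \<Rightarrow> ('a chart \<Rightarrow> real^3 \<Rightarrow> real^3 \<Rightarrow> real^3 \<Rightarrow> real) \<Rightarrow> bool" where
  "pseudo_Riemannian_metric A g \<longleftrightarrow>
     (\<forall>c\<in>A. \<forall>x\<in>coord_dom c. bilinear (g c x)) \<and>
     (\<forall>c\<in>A. \<forall>u v. smooth_on (coord_dom c) (\<lambda>x. g c x u v)) \<and>
     (\<forall>c\<in>A. \<forall>d\<in>A. \<forall>x\<in>overlap c d. \<forall>u v.
        g d (transition c d x) (jac c d x u) (jac c d x v) = g c x u v) \<and>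
     (\<forall>c\<in>A. \<forall>x\<in>coord_dom c. \<forall>u v. g c x u v = g c x v u) \<and>
     (\<forall>c\<in>A. \<forall>x\<in>coord_dom c. \<forall>u. (\<forall>v. g c x u v = 0) \<longrightarrow> u = 0)"


section \<open>Differential operators in coordinates\<close>

text \<open>Here \<open>X\<close>, \<open>Y\<close>, \<open>Z\<close> are vector fields on an open subset of \<open>real^3\<close>, and \<open>\<eta>\<close>, \<open>\<phi>\<close>, \<open>g\<close>
  are representatives of tensor fields in a single chart.\<close>

definition lie_bracket ::
  "(real^3 \<Rightarrow> real^3) \<Rightarrow> (real^3 \<Rightarrow> real^3) \<Rightarrow> real^3 \<Rightarrow> real^3" where
  "lie_bracket X Y x = frechet_derivative Y (at x) (X x) - frechet_derivative X (at x) (Y x)"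

definition ext_deriv ::
  "(real^3 \<Rightarrow> real^3 \<Rightarrow> real) \<Rightarrow> (real^3 \<Rightarrow> real^3) \<Rightarrow> (real^3 \<Rightarrow> real^3) \<Rightarrow> real^3 \<Rightarrow> real" where
  "ext_deriv \<eta> X Y x = 1/2 *
     (frechet_derivative (\<lambda>y. \<eta> y (Y y)) (at x) (X x)
      - frechet_derivative (\<lambda>y. \<eta> y (X y)) (at x) (Y x)
      - \<eta> x (lie_bracket X Y x))"

definition nijenhuis ::
  "(real^3 \<Rightarrow> real^3 \<Rightarrow> real^3) \<Rightarrow> (real^3 \<Rightarrow> real^3) \<Rightarrow> (real^3 \<Rightarrow> real^3) \<Rightarrow> real^3 \<Rightarrow> real^3" where
  "nijenhuis \<phi> X Y x =
     \<phi> x (\<phi> x (lie_bracket X Y x))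
     + lie_bracket (\<lambda>y. \<phi> y (X y)) (\<lambda>y. \<phi> y (Y y)) x
     - \<phi> x (lie_bracket (\<lambda>y. \<phi> y (X y)) Y x)
     - \<phi> x (lie_bracket X (\<lambda>y. \<phi> y (Y y)) x)"

text \<open>\<open>lie_metric \<xi> g X Y\<close> is \<open>(\<L>\<^sub>\<xi> g)(X, Y) = \<xi>(g(X,Y)) - g([\<xi>,X],Y) - g(X,[\<xi>,Y])\<close>.\<close>

definition lie_metric ::
  "(real^3 \<Rightarrow> real^3) \<Rightarrow> (real^3 \<Rightarrow> real^3 \<Rightarrow> real^3 \<Rightarrow> real) \<Rightarrow>
   (real^3 \<Rightarrow> real^3) \<Rightarrow> (real^3 \<Rightarrow> real^3) \<Rightarrow> real^3 \<Rightarrow> real" where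
  "lie_metric \<xi> g X Y x =
     frechet_derivative (\<lambda>y. g y (X y) (Y y)) (at x) (\<xi> x)
     - g x (lie_bracket \<xi> X x) (Y x) - g x (X x) (lie_bracket \<xi> Y x)"

text \<open>The Christoffel form of the Levi-Civita connection: \<open>\<Gamma> u v = \<nabla>\<^sub>u v\<close> for constant \<open>u\<close>, \<open>v\<close>.
  Symmetry says that the connection is torsion-free, the last condition that it is metric.
  By the fundamental theorem of pseudo-Riemannian geometry the \<open>THE\<close> is well defined.\<close>

definition christoffel ::
  "(real^3 \<Rightarrow> real^3 \<Rightarrow> real^3 \<Rightarrow> real) \<Rightarrow> real^3 \<Rightarrow> real^3 \<Rightarrow> real^3 \<Rightarrow> real^3" where
  "christoffel g x = (THE \<Gamma>. bilinear \<Gamma> \<and> (\<forall>u v. \<Gamma> u v = \<Gamma> v u) \<and>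
     (\<forall>u v w. frechet_derivative (\<lambda>y. g y v w) (at x) u = g x (\<Gamma> u v) w + g x v (\<Gamma> u w)))"

definition nabla ::
  "(real^3 \<Rightarrow> real^3 \<Rightarrow> real^3 \<Rightarrow> real) \<Rightarrow>
   (real^3 \<Rightarrow> real^3) \<Rightarrow> (real^3 \<Rightarrow> real^3) \<Rightarrow> real^3 \<Rightarrow> real^3" where
  "nabla g X Y x = frechet_derivative Y (at x) (X x) + christoffel g x (X x) (Y x)"

definition curvature ::
  "(real^3 \<Rightarrow> real^3 \<Rightarrow> real^3 \<Rightarrow> real) \<Rightarrow>
   (real^3 \<Rightarrow> real^3) \<Rightarrow> (real^3 \<Rightarrow> real^3) \<Rightarrow> (real^3 \<Rightarrow> real^3) \<Rightarrow> real^3 \<Rightarrow> real^3" where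
  "curvature g X Y Z x =
     nabla g X (nabla g Y Z) x - nabla g Y (nabla g X Z) x - nabla g (lie_bracket X Y) Z x"

text \<open>The curvature is tensorial, so its value on tangent vectors \<open>u\<close>, \<open>v\<close>, \<open>w\<close> at \<open>x\<close> may be
  computed with any extensions to vector fields; we take the constant ones.\<close>

definition curvature_at ::
  "(real^3 \<Rightarrow> real^3 \<Rightarrow> real^3 \<Rightarrow> real) \<Rightarrow> real^3 \<Rightarrow> real^3 \<Rightarrow> real^3 \<Rightarrow> real^3 \<Rightarrow> real^3" where
  "curvature_at g x u v w = curvature g (\<lambda>_. u) (\<lambda>_. v) (\<lambda>_. w) x"

text \<open>\<open>\<rho>(v,w)\<close> is the trace of \<open>u \<mapsto> R(u,v)w\<close>; it is positive on round spheres.\<close>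

definition ricci ::
  "(real^3 \<Rightarrow> real^3 \<Rightarrow> real^3 \<Rightarrow> real) \<Rightarrow> real^3 \<Rightarrow> real^3 \<Rightarrow> real^3 \<Rightarrow> real" where
  "ricci g x v w = trace (matrix (\<lambda>u. curvature_at g x u v w))"

definition plane_area ::
  "(real^3 \<Rightarrow> real^3 \<Rightarrow> real^3 \<Rightarrow> real) \<Rightarrow> real^3 \<Rightarrow> real^3 \<Rightarrow> real^3 \<Rightarrow> real" where
  "plane_area g x u v = g x u u * g x v v - (g x u v)\<^sup>2"

definition sectional_curvature ::
  "(real^3 \<Rightarrow> real^3 \<Rightarrow> real^3 \<Rightarrow> real) \<Rightarrow> real^3 \<Rightarrow> real^3 \<Rightarrow> real^3 \<Rightarrow> real" where
  "sectional_curvature g x u v = g x (curvature_at g x u v v) u / plane_area g x u v"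


section \<open>Almost paracontact metric structures\<close>

locale almost_paracontact_3_manifold = connected_smooth_3_manifold M A
  for M :: "'a topology" and A :: "'a chart set" +
  fixes \<phi> :: "'a chart \<Rightarrow> real^3 \<Rightarrow> real^3 \<Rightarrow> real^3"
    and \<xi> :: "'a chart \<Rightarrow> real^3 \<Rightarrow> real^3"
    and \<eta> :: "'a chart \<Rightarrow> real^3 \<Rightarrow> real^3 \<Rightarrow> real"
  assumes phi: "tensor_11 A \<phi>"
    and xi: "vector_field A \<xi>"
    and eta: "one_form A \<eta>"
    and phi_xi: "c \<in> A \<Longrightarrow> x \<in> coord_dom c \<Longrightarrow> \<phi> c x (\<xi> c x) = 0"
    and eta_phi: "c \<in> A \<Longrightarrow> x \<in> coord_dom c \<Longrightarrow> \<eta> c x (\<phi> c x u) = 0"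
    and eta_xi: "c \<in> A \<Longrightarrow> x \<in> coord_dom c \<Longrightarrow> \<eta> c x (\<xi> c x) = 1"
    and phi_phi: "c \<in> A \<Longrightarrow> x \<in> coord_dom c \<Longrightarrow>
      \<phi> c x (\<phi> c x u) = u - \<eta> c x u *\<^sub>R \<xi> c x"
    and eigenbundle_plus: "c \<in> A \<Longrightarrow> x \<in> coord_dom c \<Longrightarrow>
      dim {u. \<eta> c x u = 0 \<and> \<phi> c x u = u} = 1"
    and eigenbundle_minus: "c \<in> A \<Longrightarrow> x \<in> coord_dom c \<Longrightarrow>
      dim {u. \<eta> c x u = 0 \<and> \<phi> c x u = - u} = 1"

locale almost_paracontact_metric_3_manifold = almost_paracontact_3_manifold M A \<phi> \<xi> \<eta>
  for M :: "'a topology" and A :: "'a chart set"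
    and \<phi> :: "'a chart \<Rightarrow> real^3 \<Rightarrow> real^3 \<Rightarrow> real^3"
    and \<xi> :: "'a chart \<Rightarrow> real^3 \<Rightarrow> real^3"
    and \<eta> :: "'a chart \<Rightarrow> real^3 \<Rightarrow> real^3 \<Rightarrow> real" +
  fixes g :: "'a chart \<Rightarrow> real^3 \<Rightarrow> real^3 \<Rightarrow> real^3 \<Rightarrow> real"
  assumes metric: "pseudo_Riemannian_metric A g"
    and compatible: "c \<in> A \<Longrightarrow> x \<in> coord_dom c \<Longrightarrow>
      g c x (\<phi> c x u) (\<phi> c x v) = - g c x u v + \<eta> c x u * \<eta> c x v"

text \<open>Identities between tensor fields are tested, chart by chart, on all smooth vector fields on
  the coordinate domain.\<close>

locale normal_almost_paracontact_metric_3_manifold =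
  almost_paracontact_metric_3_manifold M A \<phi> \<xi> \<eta> g
  for M :: "'a topology" and A :: "'a chart set"
    and \<phi> :: "'a chart \<Rightarrow> real^3 \<Rightarrow> real^3 \<Rightarrow> real^3"
    and \<xi> :: "'a chart \<Rightarrow> real^3 \<Rightarrow> real^3"
    and \<eta> :: "'a chart \<Rightarrow> real^3 \<Rightarrow> real^3 \<Rightarrow> real"
    and g :: "'a chart \<Rightarrow> real^3 \<Rightarrow> real^3 \<Rightarrow> real^3 \<Rightarrow> real" +
  assumes normal: "c \<in> A \<Longrightarrow> smooth_on (coord_dom c) X \<Longrightarrow> smooth_on (coord_dom c) Y \<Longrightarrow>
    x \<in> coord_dom c \<Longrightarrow>
    nijenhuis (\<phi> c) X Y x - (2 * ext_deriv (\<eta> c) X Y x) *\<^sub>R \<xi> c x = 0"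

definition conformal_Killing ::
  "'a chart set \<Rightarrow> ('a chart \<Rightarrow> real^3 \<Rightarrow> real^3 \<Rightarrow> real^3 \<Rightarrow> real) \<Rightarrow>
   ('a chart \<Rightarrow> real^3 \<Rightarrow> real^3) \<Rightarrow> bool" where
  "conformal_Killing A g \<xi> \<longleftrightarrow> vector_field A \<xi> \<and>
     (\<exists>f. smooth_function A f \<and>
       (\<forall>c\<in>A. \<forall>X Y. smooth_on (coord_dom c) X \<longrightarrow> smooth_on (coord_dom c) Y \<longrightarrow>
         (\<forall>x\<in>coord_dom c. lie_metric (\<xi> c) (g c) X Y x = f (coord_inv c x) * g c x (X x) (Y x))))"

definition Killing ::
  "'a chart set \<Rightarrow> ('a chart \<Rightarrow> real^3 \<Rightarrow> real^3 \<Rightarrow> real^3 \<Rightarrow> real) \<Rightarrow>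
   ('a chart \<Rightarrow> real^3 \<Rightarrow> real^3) \<Rightarrow> bool" where
  "Killing A g \<xi> \<longleftrightarrow> vector_field A \<xi> \<and>
     (\<forall>c\<in>A. \<forall>X Y. smooth_on (coord_dom c) X \<longrightarrow> smooth_on (coord_dom c) Y \<longrightarrow>
       (\<forall>x\<in>coord_dom c. lie_metric (\<xi> c) (g c) X Y x = 0))"

definition ricci_soliton ::
  "'a chart set \<Rightarrow> ('a chart \<Rightarrow> real^3 \<Rightarrow> real^3 \<Rightarrow> real^3 \<Rightarrow> real) \<Rightarrow>
   ('a chart \<Rightarrow> real^3 \<Rightarrow> real^3) \<Rightarrow> bool" where
  "ricci_soliton A g \<xi> \<longleftrightarrow> vector_field A \<xi> \<and>
     (\<exists>l::real. \<forall>c\<in>A. \<forall>X Y. smooth_on (coord_dom c) X \<longrightarrow> smooth_on (coord_dom c) Y \<longrightarrow>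
       (\<forall>x\<in>coord_dom c.
         lie_metric (\<xi> c) (g c) X Y x + ricci (g c) x (X x) (Y x) = l * g c x (X x) (Y x)))"

definition constant_sectional_curvature ::
  "'a chart set \<Rightarrow> ('a chart \<Rightarrow> real^3 \<Rightarrow> real^3 \<Rightarrow> real^3 \<Rightarrow> real) \<Rightarrow> real \<Rightarrow> bool" where
  "constant_sectional_curvature A g k \<longleftrightarrow>
     (\<forall>c\<in>A. \<forall>x\<in>coord_dom c. \<forall>u v. plane_area (g c) x u v \<noteq> 0 \<longrightarrow>
        sectional_curvature (g c) x u v = k)"

end

theory Submission
  imports Defs
begin

text \<open>
  Compatibility gives \<open>g(\<xi>,\<xi>) = 1\<close>, and evaluating \<open>\<L>\<^sub>\<xi> g = f g\<close> on the pair \<open>(\<xi>,\<xi>)\<close> yields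
  \<open>f = \<xi>(g(\<xi>,\<xi>)) - 2 g([\<xi>,\<xi>],\<xi>) = 0\<close>.

  A soliton with Killing \<open>\<xi>\<close> is Einstein, \<open>\<rho> = l g\<close>, and in dimension three this forces all
  sectional curvatures to equal \<open>l/2\<close>.  For the sign, put \<open>h = \<nabla>\<xi>\<close>, which is skew with \<open>h \<xi> = 0\<close>,
  so that \<open>g(R(a,\<xi>)\<xi>,a) = g(h a,h a)\<close>.  If \<open>a\<close> is a unit vector in \<open>ker \<eta>\<close>, then \<open>\<xi>, a, \<phi> a\<close> is an
  orthonormal frame in which \<open>a\<close> and \<open>\<phi> a\<close> have opposite signs; skewness gives \<open>h a = \<alpha> \<phi> a\<close>, hence
  \<open>g(h a,h a) = - \<alpha>\<^sup>2 g(a,a)\<close> and \<open>l/2 = - \<alpha>\<^sup>2 \<le> 0\<close>.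
\<close>

section \<open>Directional derivatives\<close>

abbreviation dderiv :: "('e::real_normed_vector \<Rightarrow> 'f::real_normed_vector) \<Rightarrow> 'e \<Rightarrow> 'e \<Rightarrow> 'f" where
  "dderiv f x v \<equiv> frechet_derivative f (at x) v"

lemma dderivI: "(f has_derivative f') (at x) \<Longrightarrow> dderiv f x v = f' v"
  by (simp add: frechet_derivative_at[symmetric])

text \<open>The Frechet derivative is a choice from the predicate \<open>has_derivative\<close>, so
  it suffices that both functions have the same derivatives at \<open>x\<close>; the equality then
  holds even where no derivative exists.\<close>

lemma dderiv_cong:
  assumes "open S" "x \<in> S" "\<And>y. y \<in> S \<Longrightarrow> f y = g y"
  shows "dderiv f x v = dderiv g x v"
proof -
  have "(f has_derivative f') (at x) \<longleftrightarrow> (g has_derivative f') (at x)" for f'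
    by (rule iffI; erule has_derivative_transform_within_open[OF _ assms(1,2)]) (simp_all add: assms(3))
  then show ?thesis
    by (simp add: frechet_derivative_def)
qed

lemma dderiv_works:
  "f differentiable (at x) \<Longrightarrow> (f has_derivative dderiv f x) (at x)"
  by (simp add: frechet_derivative_works[symmetric])

text \<open>A product rule for a field of linear maps whose derivative is known for each fixed
  argument. Expanding the argument in a basis turns the application into a finite sum of scalar
  multiples.\<close>

lemma has_derivative_linear_apply:
  fixes B :: "'a::real_normed_vector \<Rightarrow> 'b::euclidean_space \<Rightarrow> 'c::real_normed_vector"
  assumes S: "open S" "x \<in> S" and lin: "\<And>y. y \<in> S \<Longrightarrow> linear (B y)"
    and B: "\<And>u. ((\<lambda>y. B y u) has_derivative (\<lambda>a. B' a u)) (at x)"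
    and F: "(F has_derivative F') (at x)"
  shows "((\<lambda>y. B y (F y)) has_derivative (\<lambda>a. B' a (F x) + B x (F' a))) (at x)"
proof -
  have expand: "B y w = (\<Sum>b\<in>Basis. (w \<bullet> b) *\<^sub>R B y b)" if "y \<in> S" for y w
  proof -
    interpret linear "B y" by (rule lin[OF that])
    have "B y w = B y (\<Sum>b\<in>Basis. (w \<bullet> b) *\<^sub>R b)"
      by (simp only: euclidean_representation)
    also have "\<dots> = (\<Sum>b\<in>Basis. (w \<bullet> b) *\<^sub>R B y b)"
      by (simp only: sum scaleR)
    finally show ?thesis .
  qed
  have "((\<lambda>y. \<Sum>b\<in>Basis. (F x \<bullet> b) *\<^sub>R B y b) has_derivative
      (\<lambda>a. \<Sum>b\<in>Basis. (F x \<bullet> b) *\<^sub>R B' a b)) (at x)"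
    by (intro derivative_intros B)
  then have "((\<lambda>y. B y (F x)) has_derivative (\<lambda>a. \<Sum>b\<in>Basis. (F x \<bullet> b) *\<^sub>R B' a b)) (at x)"
    by (rule has_derivative_transform_within_open[OF _ S]) (simp add: expand[of _ "F x", symmetric])
  then have B': "(\<lambda>a. \<Sum>b\<in>Basis. (F x \<bullet> b) *\<^sub>R B' a b) = (\<lambda>a. B' a (F x))"
    using B has_derivative_unique by blast
  have "((\<lambda>y. \<Sum>b\<in>Basis. (F y \<bullet> b) *\<^sub>R B y b) has_derivative
      (\<lambda>a. \<Sum>b\<in>Basis. (F x \<bullet> b) *\<^sub>R B' a b + (F' a \<bullet> b) *\<^sub>R B x b)) (at x)"
    by (intro has_derivative_sum has_derivative_scaleR has_derivative_inner_left B F)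
  then have "((\<lambda>y. B y (F y)) has_derivative
      (\<lambda>a. \<Sum>b\<in>Basis. (F x \<bullet> b) *\<^sub>R B' a b + (F' a \<bullet> b) *\<^sub>R B x b)) (at x)"
    by (rule has_derivative_transform_within_open[OF _ S]) (rule expand[symmetric])
  moreover have "(\<lambda>a. \<Sum>b\<in>Basis. (F x \<bullet> b) *\<^sub>R B' a b + (F' a \<bullet> b) *\<^sub>R B x b)
      = (\<lambda>a. B' a (F x) + B x (F' a))"
    using fun_cong[OF B'] by (simp add: sum.distrib expand[OF S(2), symmetric])
  ultimately show ?thesis by simp
qed

lemma has_derivative_bilinear_apply:
  fixes B :: "'a::real_normed_vector \<Rightarrow> 'b::euclidean_space \<Rightarrow> 'd::euclidean_space \<Rightarrow> 'c::real_normed_vector"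
  assumes S: "open S" "x \<in> S" and lin: "\<And>y. y \<in> S \<Longrightarrow> bilinear (B y)"
    and B: "\<And>u v. ((\<lambda>y. B y u v) has_derivative (\<lambda>a. B' a u v)) (at x)"
    and F: "(F has_derivative F') (at x)" and G: "(G has_derivative G') (at x)"
  shows "((\<lambda>y. B y (F y) (G y)) has_derivative
    (\<lambda>a. B' a (F x) (G x) + B x (F' a) (G x) + B x (F x) (G' a))) (at x)"
proof (rule has_derivative_linear_apply[where B = "\<lambda>y. B y (F y)"
      and B' = "\<lambda>a v. B' a (F x) v + B x (F' a) v", OF S _ _ G])
  show "linear (B y (F y))" if "y \<in> S" for y
    using lin[OF that] by (simp add: bilinear_def)
  show "((\<lambda>y. B y (F y) v) has_derivative (\<lambda>a. B' a (F x) v + B x (F' a) v)) (at x)" for v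
    by (rule has_derivative_linear_apply[where B = "\<lambda>y u. B y u v" and B' = "\<lambda>a u. B' a u v", OF S _ B F])
      (use lin in \<open>simp add: bilinear_def\<close>)
qed

section \<open>Symmetry of second derivatives\<close>

lemma DERIV_along_line:
  fixes f :: "'e::real_normed_vector \<Rightarrow> real"
  assumes "f differentiable (at (p + s *\<^sub>R u))"
  shows "((\<lambda>s. f (p + s *\<^sub>R u)) has_real_derivative dderiv f (p + s *\<^sub>R u) u) (at s)"
proof -
  have "((\<lambda>s. f (p + s *\<^sub>R u)) has_derivative (\<lambda>h. dderiv f (p + s *\<^sub>R u) (h *\<^sub>R u))) (at s)"
    by (rule has_derivative_compose[where f = "\<lambda>s. p + s *\<^sub>R u" and g = f, OF _ dderiv_works[OF assms]])
      (auto intro!: derivative_eq_intros)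
  moreover have "dderiv f (p + s *\<^sub>R u) (h *\<^sub>R u) = dderiv f (p + s *\<^sub>R u) u * h" for h
    using linear_cmul[OF linear_frechet_derivative[OF assms]] by (simp add: mult.commute)
  ultimately show ?thesis
    by (simp add: has_field_derivative_def)
qed

text \<open>The second difference is symmetric in \<open>u\<close> and \<open>v\<close>, which makes
  mixed derivatives comparable. The mean value theorem, applied along \<open>u\<close> and then
  along \<open>v\<close>, turns the quotient into a mixed derivative at a nearby point; continuity
  gives the limit.\<close>

lemma second_difference_tendsto:
  fixes f :: "'e::real_normed_vector \<Rightarrow> real"
  assumes S: "open S" "x \<in> S" and f: "\<And>y. y \<in> S \<Longrightarrow> f differentiable (at y)"
    and f': "\<And>y. y \<in> S \<Longrightarrow> (\<lambda>y. dderiv f y u) differentiable (at y)"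
    and f'': "continuous_on S (\<lambda>y. dderiv (\<lambda>y. dderiv f y u) y v)"
  shows "((\<lambda>t. (f (x + t *\<^sub>R u + t *\<^sub>R v) - f (x + t *\<^sub>R u) - f (x + t *\<^sub>R v) + f x) / t\<^sup>2)
    \<longlongrightarrow> dderiv (\<lambda>y. dderiv f y u) x v) (at_right 0)"
proof (rule tendstoI)
  fix e :: real assume "e > 0"
  let ?L = "\<lambda>y. dderiv (\<lambda>y. dderiv f y u) y v"
  have "\<exists>d1>0. \<forall>y\<in>S. dist y x < d1 \<longrightarrow> dist (?L y) (?L x) < e"
    using f'' S(2) \<open>e > 0\<close> unfolding continuous_on_iff by blast
  then obtain d1 where d1: "d1 > 0" "\<And>y. y \<in> S \<Longrightarrow> dist y x < d1 \<Longrightarrow> dist (?L y) (?L x) < e"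
    by blast
  obtain d2 where d2: "d2 > 0" "ball x d2 \<subseteq> S"
    using S open_contains_ball by blast
  \<comment> \<open>For parameters in \<open>[0, t]\<close> with \<open>t < d\<close> the points
    stay in \<open>S\<close> and within \<open>d1\<close> of \<open>x\<close>; the summand 1 keeps
    the denominator positive when \<open>u\<close> and \<open>v\<close> vanish.\<close>
  define d where "d = min d1 d2 / (norm u + norm v + 1)"
  have pos: "norm u + norm v + 1 > 0" by (simp add: add_nonneg_pos)
  have "d > 0" using d1 d2 pos by (simp add: d_def)
  have near: "norm (s *\<^sub>R u + r *\<^sub>R v) < min d1 d2" if "0 \<le> s" "s \<le> t" "0 \<le> r" "r \<le> t" "t < d" for s r t
  proof -
    have "norm (s *\<^sub>R u + r *\<^sub>R v) \<le> s * norm u + r * norm v"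
      using norm_triangle_ineq[of "s *\<^sub>R u" "r *\<^sub>R v"] that by simp
    also have "\<dots> \<le> t * norm u + t * norm v"
      using that by (intro add_mono mult_right_mono) auto
    also have "\<dots> \<le> t * (norm u + norm v + 1)"
      using that by (simp add: algebra_simps)
    also have "\<dots> < d * (norm u + norm v + 1)"
      using that pos by (intro mult_strict_right_mono) auto
    finally show ?thesis using pos by (simp add: d_def)
  qed
  have inS: "x + s *\<^sub>R u + r *\<^sub>R v \<in> S" if "0 \<le> s" "s \<le> t" "0 \<le> r" "r \<le> t" "t < d" for s r t
  proof -
    have "x + s *\<^sub>R u + r *\<^sub>R v = x + (s *\<^sub>R u + r *\<^sub>R v)" by simp
    moreover have "dist x (x + w) = norm w" for w
      by (simp add: dist_norm)
    then have "x + (s *\<^sub>R u + r *\<^sub>R v) \<in> ball x d2"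
      using near[OF that] unfolding mem_ball by (metis min_less_iff_conj)
    ultimately show ?thesis using d2(2) by (metis subsetD)
  qed
  have "\<forall>\<^sub>F t in at_right 0. t \<in> {0<..<d}"
    by (rule eventually_at_right_real[OF \<open>d > 0\<close>])
  then show "\<forall>\<^sub>F t in at_right 0.
    dist ((f (x + t *\<^sub>R u + t *\<^sub>R v) - f (x + t *\<^sub>R u) - f (x + t *\<^sub>R v) + f x) / t\<^sup>2) (?L x) < e"
  proof (rule eventually_mono)
    fix t assume "t \<in> {0<..<d}"
    then have t: "0 < t" "t < d" by auto
    \<comment> \<open>The increment of this function of \<open>s\<close> over \<open>[0, t]\<close>
      is the second difference.\<close>
    have "((\<lambda>s. f (x + s *\<^sub>R u + t *\<^sub>R v) - f (x + s *\<^sub>R u)) has_real_derivative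
        dderiv f (x + s *\<^sub>R u + t *\<^sub>R v) u - dderiv f (x + s *\<^sub>R u) u) (at s)"
      if "0 \<le> s" "s \<le> t" for s
    proof (rule DERIV_diff)
      show "((\<lambda>s. f (x + s *\<^sub>R u)) has_real_derivative dderiv f (x + s *\<^sub>R u) u) (at s)"
        using DERIV_along_line[OF f] inS[of s t 0] that t by simp
      have swap: "x + t *\<^sub>R v + s *\<^sub>R u = x + s *\<^sub>R u + t *\<^sub>R v" for s
        by simp
      show "((\<lambda>s. f (x + s *\<^sub>R u + t *\<^sub>R v)) has_real_derivative dderiv f (x + s *\<^sub>R u + t *\<^sub>R v) u) (at s)"
        using DERIV_along_line[OF f, of "x + t *\<^sub>R v" s u] inS[of s t t] that t
        unfolding swap by simp
    qed
    from MVT2[OF t(1) this] obtain s where s: "0 < s" "s < t"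
      and 1: "f (x + t *\<^sub>R u + t *\<^sub>R v) - f (x + t *\<^sub>R u) - (f (x + t *\<^sub>R v) - f x)
        = t * (dderiv f (x + s *\<^sub>R u + t *\<^sub>R v) u - dderiv f (x + s *\<^sub>R u) u)"
      by auto
    have "((\<lambda>r. dderiv f (x + s *\<^sub>R u + r *\<^sub>R v) u) has_real_derivative ?L (x + s *\<^sub>R u + r *\<^sub>R v)) (at r)"
      if "0 \<le> r" "r \<le> t" for r
      using DERIV_along_line[OF f'] inS[of s t r] that t s by simp
    from MVT2[OF t(1) this] obtain r where r: "0 < r" "r < t"
      and 2: "dderiv f (x + s *\<^sub>R u + t *\<^sub>R v) u - dderiv f (x + s *\<^sub>R u) u = t * ?L (x + s *\<^sub>R u + r *\<^sub>R v)"
      by auto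
    have "f (x + t *\<^sub>R u + t *\<^sub>R v) - f (x + t *\<^sub>R u) - f (x + t *\<^sub>R v) + f x
        = t * (t * ?L (x + s *\<^sub>R u + r *\<^sub>R v))"
      using 1 unfolding 2 by linarith
    then have "(f (x + t *\<^sub>R u + t *\<^sub>R v) - f (x + t *\<^sub>R u) - f (x + t *\<^sub>R v) + f x) / t\<^sup>2 = ?L (x + s *\<^sub>R u + r *\<^sub>R v)"
      using t by (simp add: power2_eq_square)
    moreover have "dist (x + s *\<^sub>R u + r *\<^sub>R v) x < d1"
      using near[of s t r] s r t by (simp add: dist_norm add.assoc)
    ultimately show "dist ((f (x + t *\<^sub>R u + t *\<^sub>R v) - f (x + t *\<^sub>R u) - f (x + t *\<^sub>R v) + f x) / t\<^sup>2) (?L x) < e"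
      using d1 inS[of s t r] s r t by simp
  qed
qed

lemma Ck_on_2_differentiable:
  assumes "open S" "Ck_on 2 S f" "x \<in> S"
  shows "f differentiable (at x)" "(\<lambda>y. dderiv f y u) differentiable (at x)"
  using assms by (auto simp: numeral_2_eq_2 differentiable_on_eq_differentiable_at)

lemma dderiv_inner_left:
  assumes "f differentiable (at x)"
  shows "dderiv (\<lambda>y. f y \<bullet> b) x v = dderiv f x v \<bullet> b"
  by (rule dderivI) (intro has_derivative_inner_left dderiv_works assms)

text \<open>Schwarz's theorem. The mean value theorem concerns real functions, so the components are
  treated one by one; both mixed derivatives are limits of the same quotient.\<close>

lemma dderiv_dderiv_commute:
  fixes f :: "'e::euclidean_space \<Rightarrow> 'f::euclidean_space"
  assumes S: "open S" "x \<in> S" and f: "Ck_on 2 S f"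
  shows "dderiv (\<lambda>y. dderiv f y u) x v = dderiv (\<lambda>y. dderiv f y v) x u"
proof (rule euclidean_eqI)
  fix b :: 'f assume "b \<in> Basis"
  let ?f = "\<lambda>y. f y \<bullet> b"
  note diff = Ck_on_2_differentiable[OF S(1) f]
  have D: "dderiv ?f y w = dderiv f y w \<bullet> b" if "y \<in> S" for y w
    by (rule dderiv_inner_left) (rule diff[OF that])
  have DD: "dderiv (\<lambda>y. dderiv ?f y w) y w' = dderiv (\<lambda>y. dderiv f y w) y w' \<bullet> b"
    if "y \<in> S" for y w w'
    using dderiv_cong[OF S(1) that D] dderiv_inner_left[OF diff(2)[OF that]] by simp
  have d1: "?f differentiable (at y)" if "y \<in> S" for y
    using diff(1)[OF that] by (auto simp: differentiable_def intro!: has_derivative_inner_left)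
  have d2: "(\<lambda>y. dderiv ?f y w) differentiable (at y)" if "y \<in> S" for y w
  proof -
    have "((\<lambda>y. dderiv f y w \<bullet> b) has_derivative (\<lambda>a. dderiv (\<lambda>y. dderiv f y w) y a \<bullet> b)) (at y)"
      by (rule has_derivative_inner_left[OF dderiv_works[OF diff(2)[OF that]]])
    then have "((\<lambda>y. dderiv ?f y w) has_derivative (\<lambda>a. dderiv (\<lambda>y. dderiv f y w) y a \<bullet> b)) (at y)"
      by (rule has_derivative_transform_within_open[OF _ S(1) that]) (rule D[symmetric])
    then show ?thesis
      unfolding differentiable_def by blast
  qed
  have c: "continuous_on S (\<lambda>y. dderiv (\<lambda>y. dderiv ?f y w) y w')" for w w'
  proof -
    have "continuous_on S (\<lambda>y. dderiv (\<lambda>y. dderiv f y w) y w')"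
      using f by (simp add: numeral_2_eq_2)
    then have "continuous_on S (\<lambda>y. dderiv (\<lambda>y. dderiv f y w) y w' \<bullet> b)"
      by (intro continuous_intros)
    then show ?thesis
      by (rule continuous_on_eq) (simp add: DD)
  qed
  have swap: "?f (x + t *\<^sub>R v + t *\<^sub>R u) - ?f (x + t *\<^sub>R v) - ?f (x + t *\<^sub>R u) + ?f x
    = ?f (x + t *\<^sub>R u + t *\<^sub>R v) - ?f (x + t *\<^sub>R u) - ?f (x + t *\<^sub>R v) + ?f x" for t
    by (simp add: add.assoc add.commute[of "t *\<^sub>R v"])
  have "dderiv (\<lambda>y. dderiv ?f y u) x v = dderiv (\<lambda>y. dderiv ?f y v) x u"
    using second_difference_tendsto[OF S d1 d2 c, of u v] second_difference_tendsto[OF S d1 d2 c, of v u]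
    unfolding swap by (rule tendsto_unique[OF trivial_limit_at_right_real])
  then show "dderiv (\<lambda>y. dderiv f y u) x v \<bullet> b = dderiv (\<lambda>y. dderiv f y v) x u \<bullet> b"
    by (simp add: DD S)
qed

lemma Ck_on_const: "Ck_on k S (\<lambda>_. c)"
  by (induction k arbitrary: c) auto

lemma smooth_on_const: "smooth_on S (\<lambda>_. c)"
  by (simp add: smooth_on_def Ck_on_const)

section \<open>The Levi-Civita connection of a metric on an open set\<close>

lemma differentiable_vec_nth_iff:
  fixes f :: "'a::real_normed_vector \<Rightarrow> real^'n"
  shows "f differentiable (at x) \<longleftrightarrow> (\<forall>k. (\<lambda>y. f y $ k) differentiable (at x))"
  by (simp add: differentiable_componentwise_within[of f] Basis_vec_def inner_axis)

lemma differentiable_det_3: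
  assumes "\<And>i j. (\<lambda>y. A y $ i $ j) differentiable (at x)"
  shows "(\<lambda>y. det (A y :: real^3^3)) differentiable (at x)"
  unfolding det_3 by (intro differentiable_add differentiable_diff differentiable_mult assms)

lemma linear_eq_axis:
  fixes f :: "real^'n \<Rightarrow> 'a::real_vector"
  assumes "linear f" "linear f'" "\<And>i. f (axis i 1) = f' (axis i 1)"
  shows "f w = f' w"
  by (rule fun_cong[OF linear_eq_stdbasis[OF assms(1,2)]]) (auto simp: Basis_vec_def assms(3))

text \<open>Class C2 is what curvature uses: the Christoffel form contains first derivatives of the
  metric and is differentiated once more.\<close>

locale metric_on_open =
  fixes S :: "(real^3) set" and g :: "real^3 \<Rightarrow> real^3 \<Rightarrow> real^3 \<Rightarrow> real"
  assumes open_S: "open S"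
    and bilinear_g: "x \<in> S \<Longrightarrow> bilinear (g x)"
    and Ck2_g: "Ck_on 2 S (\<lambda>x. g x u v)"
    and sym_g: "x \<in> S \<Longrightarrow> g x u v = g x v u"
    and nondegenerate: "x \<in> S \<Longrightarrow> (\<And>v. g x u v = 0) \<Longrightarrow> u = 0"
begin

lemma linear_g1: "x \<in> S \<Longrightarrow> linear (\<lambda>u. g x u v)"
  and linear_g2: "x \<in> S \<Longrightarrow> linear (g x u)"
  using bilinear_g by (auto simp: bilinear_def)

lemmas g_simps =
  bilinear_ladd[OF bilinear_g] bilinear_radd[OF bilinear_g]
  bilinear_lmul[OF bilinear_g] bilinear_rmul[OF bilinear_g]
  bilinear_lneg[OF bilinear_g] bilinear_rneg[OF bilinear_g]
  bilinear_lsub[OF bilinear_g] bilinear_rsub[OF bilinear_g]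
  bilinear_lzero[OF bilinear_g] bilinear_rzero[OF bilinear_g]

lemma metric_eqI:
  assumes "x \<in> S" "\<And>w. g x u w = g x v w"
  shows "u = v"
  using nondegenerate[OF assms(1), of "u - v"] assms by (simp add: g_simps)

abbreviation Dg :: "real^3 \<Rightarrow> real^3 \<Rightarrow> real^3 \<Rightarrow> real^3 \<Rightarrow> real" where
  "Dg x u v w \<equiv> dderiv (\<lambda>y. g y v w) x u"

lemma differentiable_g: "x \<in> S \<Longrightarrow> (\<lambda>y. g y v w) differentiable (at x)"
  and differentiable_Dg: "x \<in> S \<Longrightarrow> (\<lambda>y. Dg y u v w) differentiable (at x)"
  using Ck_on_2_differentiable[OF open_S Ck2_g] by auto

lemma Dg_sym: "x \<in> S \<Longrightarrow> Dg x u v w = Dg x u w v"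
  by (rule dderiv_cong[OF open_S]) (auto simp: sym_g)

lemma linear_Dg1: "x \<in> S \<Longrightarrow> linear (\<lambda>u. Dg x u v w)"
  by (rule linear_frechet_derivative[OF differentiable_g])

lemma linear_Dg2: assumes "x \<in> S" shows "linear (\<lambda>v. Dg x u v w)"
proof (rule linearI)
  fix v v' and r :: real
  have "Dg x u (v + v') w = dderiv (\<lambda>y. g y v w + g y v' w) x u"
    by (rule dderiv_cong[OF open_S assms]) (simp add: g_simps)
  also have "\<dots> = Dg x u v w + Dg x u v' w"
    by (rule dderivI) (intro has_derivative_add dderiv_works differentiable_g assms)
  finally show "Dg x u (v + v') w = Dg x u v w + Dg x u v' w" .
  have "Dg x u (r *\<^sub>R v) w = dderiv (\<lambda>y. r *\<^sub>R g y v w) x u"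
    by (rule dderiv_cong[OF open_S assms]) (simp add: g_simps)
  also have "\<dots> = r *\<^sub>R Dg x u v w"
    by (rule dderivI) (intro has_derivative_scaleR_right dderiv_works differentiable_g assms)
  finally show "Dg x u (r *\<^sub>R v) w = r *\<^sub>R Dg x u v w" .
qed

lemma linear_Dg3: "x \<in> S \<Longrightarrow> linear (\<lambda>w. Dg x u v w)"
  using linear_Dg2[where w = v] by (simp add: Dg_sym[where v = v])

section \<open>Inverting the metric in coordinates\<close>

definition gram :: "real^3 \<Rightarrow> real^3^3" where
  "gram x = (\<chi> i j. g x (axis i 1) (axis j 1))"

text \<open>Inverts the metric by Cramer's rule, which exhibits the dependence on \<open>x\<close> as rational.\<close>

definition sharp :: "real^3 \<Rightarrow> real^3 \<Rightarrow> real^3" where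
  "sharp x b = (\<chi> k. det (\<chi> i j. if j = k then b $ i else gram x $ i $ j) / det (gram x))"

lemma gram_mult: assumes "x \<in> S" shows "gram x *v z = (\<chi> i. g x (axis i 1) z)"
proof -
  have "g x u z = (\<Sum>j\<in>UNIV. g x u (axis j 1) * z $ j)" for u
  proof -
    have "g x u (\<Sum>j\<in>UNIV. z $ j *\<^sub>R axis j 1) = (\<Sum>j\<in>UNIV. g x u (axis j 1) * z $ j)"
      by (simp add: linear_sum[OF linear_g2[OF assms]] g_simps[OF assms] mult.commute)
    then show ?thesis
      using basis_expansion[of z] by (simp add: scalar_mult_eq_scaleR)
  qed
  then show ?thesis
    by (simp add: gram_def matrix_vector_mult_def vec_eq_iff)
qed

text \<open>A vector in the kernel of the Gram matrix is orthogonal to the standard basis, hence to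
  everything, and nondegeneracy makes it zero.\<close>

lemma det_gram: assumes "x \<in> S" shows "det (gram x) \<noteq> 0"
proof -
  have "z = 0" if "gram x *v z = 0" for z
  proof (rule nondegenerate[OF assms])
    fix v
    have "g x v z = 0"
      by (rule linear_eq_axis[of "\<lambda>v. g x v z" "\<lambda>_. 0", simplified])
        (use that in \<open>auto simp: gram_mult[OF assms] vec_eq_iff linear_g1[OF assms] linear_zero\<close>)
    then show "g x z v = 0" by (simp add: sym_g[OF assms, of z])
  qed
  then show ?thesis
    unfolding det_nz_iff_inj[OF matrix_vector_mul_linear, of "gram x", simplified]
    by (subst linear_injective_0) auto
qed

lemma metric_sharp: "x \<in> S \<Longrightarrow> g x (axis i 1) (sharp x b) = b $ i"
  using cramer[OF det_gram, of x "sharp x b" b] by (simp add: sharp_def gram_mult vec_eq_iff)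

lemma differentiable_sharp:
  assumes "x \<in> S" "b differentiable (at x)"
  shows "(\<lambda>y. sharp y (b y)) differentiable (at x)"
proof -
  have "(\<lambda>y. gram y $ i $ j) differentiable (at x)" for i j
    by (simp add: gram_def differentiable_g assms)
  moreover have "(\<lambda>y. b y $ i) differentiable (at x)" for i
    using assms differentiable_vec_nth_iff by blast
  ultimately have "(\<lambda>y. if j = k then b y $ i else gram y $ i $ j) differentiable (at x)" for i j k
    by (cases "j = k") simp_all
  then have "(\<lambda>y. sharp y (b y) $ k) differentiable (at x)" for k
    unfolding sharp_def vec_lambda_beta
    using \<open>\<And>i j. (\<lambda>y. gram y $ i $ j) differentiable (at x)\<close>
    by (intro differentiable_divide differentiable_det_3) (auto simp: det_gram assms)
  then show ?thesis
    by (simp add: differentiable_vec_nth_iff[of "\<lambda>y. sharp y (b y)"])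
qed

section \<open>The Koszul formula on constant fields and the Christoffel form\<close>

definition koszul :: "real^3 \<Rightarrow> real^3 \<Rightarrow> real^3 \<Rightarrow> real^3 \<Rightarrow> real" where
  "koszul x u v w = (Dg x u v w + Dg x v u w - Dg x w u v) / 2"

lemma linear_koszul:
  assumes "x \<in> S"
  shows "linear (\<lambda>u. koszul x u v w)" "linear (\<lambda>v. koszul x u v w)" "linear (\<lambda>w. koszul x u v w)"
  using linear_Dg1[OF assms] linear_Dg2[OF assms] linear_Dg3[OF assms]
  by (simp_all add: koszul_def linear_iff algebra_simps add_divide_distrib diff_divide_distrib)

abbreviation \<Gamma> :: "real^3 \<Rightarrow> real^3 \<Rightarrow> real^3 \<Rightarrow> real^3" where
  "\<Gamma> \<equiv> christoffel g"

text \<open>The fundamental theorem of pseudo-Riemannian geometry at a point. The Koszul formula,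
  whose bracket terms vanish on constant fields, prescribes every product
  \<open>g x (\<Gamma> x u v) w\<close>, and \<open>sharp\<close> recovers the vector from these
  products.\<close>

lemma christoffel_characterization:
  assumes "x \<in> S"
  shows "\<Gamma> x = (\<lambda>u v. sharp x (\<chi> i. koszul x u v (axis i 1)))"
    and "bilinear (\<Gamma> x)" and "\<Gamma> x u v = \<Gamma> x v u"
    and "Dg x u v w = g x (\<Gamma> x u v) w + g x v (\<Gamma> x u w)"
proof -
  define G where "G = (\<lambda>u v. sharp x (\<chi> i. koszul x u v (axis i 1)))"
  have G: "g x (G u v) w = koszul x u v w" for u v w
    by (rule linear_eq_axis[OF linear_g2[OF assms] linear_koszul(3)[OF assms]])
      (subst sym_g[OF assms], simp add: metric_sharp[OF assms] G_def)
  have bil: "bilinear G"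
    using linear_koszul[OF assms]
    by (auto simp: bilinear_def linear_iff G g_simps[OF assms] intro!: metric_eqI[OF assms])
  have sym: "G u v = G v u" for u v
    by (rule metric_eqI[OF assms]) (simp add: G koszul_def Dg_sym[OF assms, where v = v and w = u])
  have met: "Dg x u v w = g x (G u v) w + g x v (G u w)" for u v w
    using Dg_sym[OF assms, of u w v] Dg_sym[OF assms, of w v u] Dg_sym[OF assms, of v w u]
    by (simp add: G koszul_def sym_g[OF assms, of v] field_simps)
  have "\<Gamma> x = G"
    unfolding christoffel_def
  proof (rule the_equality)
    fix H assume "bilinear H \<and> (\<forall>u v. H u v = H v u) \<and>
      (\<forall>u v w. Dg x u v w = g x (H u v) w + g x v (H u w))"
    then have sym: "\<And>u v. H u v = H v u"
      and met: "\<And>u v w. Dg x u v w = g x (H u v) w + g x v (H u w)" by auto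
    \<comment> \<open>Uniqueness: after the metric condition is put into the three terms of
      \<open>koszul\<close>, symmetry of \<open>H\<close> cancels everything except twice the wanted
      product.\<close>
    have "g x (H u v) w = koszul x u v w" for u v w
      unfolding koszul_def met
      by (simp add: sym[of v u] sym[of w u] sym[of w v] sym_g[OF assms, of v] sym_g[OF assms, of u])
    then show "H = G"
      by (intro ext metric_eqI[OF assms]) (simp add: G)
  qed (use bil sym met in auto)
  then show "\<Gamma> x = (\<lambda>u v. sharp x (\<chi> i. koszul x u v (axis i 1)))"
    and "bilinear (\<Gamma> x)" and "\<Gamma> x u v = \<Gamma> x v u"
    and "Dg x u v w = g x (\<Gamma> x u v) w + g x v (\<Gamma> x u w)"
    using bil sym met by (simp_all add: G_def)
qed

lemmas bilinear_\<Gamma> = christoffel_characterization(2)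
  and sym_\<Gamma> = christoffel_characterization(3)
  and metric_compatible = christoffel_characterization(4)

lemmas \<Gamma>_simps =
  bilinear_ladd[OF bilinear_\<Gamma>] bilinear_radd[OF bilinear_\<Gamma>]
  bilinear_lmul[OF bilinear_\<Gamma>] bilinear_rmul[OF bilinear_\<Gamma>]
  bilinear_lneg[OF bilinear_\<Gamma>] bilinear_rneg[OF bilinear_\<Gamma>]
  bilinear_lsub[OF bilinear_\<Gamma>] bilinear_rsub[OF bilinear_\<Gamma>]
  bilinear_lzero[OF bilinear_\<Gamma>] bilinear_rzero[OF bilinear_\<Gamma>]

text \<open>The \<open>THE\<close> in the definition hides the dependence on the point. The formula
  through \<open>sharp\<close> exhibits it: the first derivatives of the metric in
  \<open>koszul\<close> are themselves differentiable.\<close>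

lemma differentiable_\<Gamma>:
  assumes "x \<in> S"
  shows "(\<lambda>y. \<Gamma> y u v) differentiable (at x)"
proof -
  have "(\<lambda>y. \<chi> i. koszul y u v (axis i 1)) differentiable (at x)"
    unfolding differentiable_vec_nth_iff koszul_def
    by (simp add: differentiable_Dg assms)
  then obtain D where
    "((\<lambda>y. sharp y (\<chi> i. koszul y u v (axis i 1))) has_derivative D) (at x)"
    using differentiable_sharp[OF assms] unfolding differentiable_def by blast
  then have "((\<lambda>y. \<Gamma> y u v) has_derivative D) (at x)"
    by (rule has_derivative_transform_within_open[OF _ open_S assms])
      (simp add: christoffel_characterization(1))
  then show ?thesis
    unfolding differentiable_def by blast
qed

abbreviation D\<Gamma> :: "real^3 \<Rightarrow> real^3 \<Rightarrow> real^3 \<Rightarrow> real^3 \<Rightarrow> real^3" where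
  "D\<Gamma> x u v w \<equiv> dderiv (\<lambda>y. \<Gamma> y v w) x u"

text \<open>Metric compatibility as a product rule for varying fields:
  \<open>F' a + \<Gamma> x a (F x)\<close> is the covariant derivative of \<open>F\<close> along
  \<open>a\<close>.\<close>

lemma has_derivative_metric:
  assumes "x \<in> S" "(F has_derivative F') (at x)" "(G has_derivative G') (at x)"
  shows "((\<lambda>y. g y (F y) (G y)) has_derivative
    (\<lambda>a. g x (F' a + \<Gamma> x a (F x)) (G x) + g x (F x) (G' a + \<Gamma> x a (G x)))) (at x)"
proof -
  have "((\<lambda>y. g y (F y) (G y)) has_derivative
    (\<lambda>a. Dg x a (F x) (G x) + g x (F' a) (G x) + g x (F x) (G' a))) (at x)"
    by (rule has_derivative_bilinear_apply[OF open_S assms(1) bilinear_g _ assms(2,3)])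
      (auto intro: dderiv_works differentiable_g assms)
  then show ?thesis
    by (simp add: metric_compatible[OF assms(1)] g_simps[OF assms(1)] algebra_simps)
qed

section \<open>Curvature and its symmetries\<close>

abbreviation R :: "real^3 \<Rightarrow> real^3 \<Rightarrow> real^3 \<Rightarrow> real^3 \<Rightarrow> real^3" where
  "R \<equiv> curvature_at g"

lemma curvature_at_eq:
  assumes "x \<in> S"
  shows "R x u v w = D\<Gamma> x u v w + \<Gamma> x u (\<Gamma> x v w) - (D\<Gamma> x v u w + \<Gamma> x v (\<Gamma> x u w))"
proof -
  have "nabla g (\<lambda>_. v) (\<lambda>_. w) = (\<lambda>y. \<Gamma> y v w)" for v w
    by (simp add: nabla_def fun_eq_iff)
  then show ?thesis
    by (simp add: curvature_at_def curvature_def lie_bracket_def \<Gamma>_simps[OF assms])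
      (simp add: nabla_def lie_bracket_def \<Gamma>_simps[OF assms])
qed

lemma linear_D\<Gamma>2: assumes "x \<in> S" shows "linear (\<lambda>v. D\<Gamma> x u v w)"
proof (rule linearI)
  fix v v' and r :: real
  have "D\<Gamma> x u (v + v') w = dderiv (\<lambda>y. \<Gamma> y v w + \<Gamma> y v' w) x u"
    by (rule dderiv_cong[OF open_S assms]) (simp add: \<Gamma>_simps)
  also have "\<dots> = D\<Gamma> x u v w + D\<Gamma> x u v' w"
    by (rule dderivI) (intro has_derivative_add dderiv_works differentiable_\<Gamma> assms)
  finally show "D\<Gamma> x u (v + v') w = D\<Gamma> x u v w + D\<Gamma> x u v' w" .
  have "D\<Gamma> x u (r *\<^sub>R v) w = dderiv (\<lambda>y. r *\<^sub>R \<Gamma> y v w) x u"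
    by (rule dderiv_cong[OF open_S assms]) (simp add: \<Gamma>_simps)
  also have "\<dots> = r *\<^sub>R D\<Gamma> x u v w"
    by (rule dderivI) (intro has_derivative_scaleR_right dderiv_works differentiable_\<Gamma> assms)
  finally show "D\<Gamma> x u (r *\<^sub>R v) w = r *\<^sub>R D\<Gamma> x u v w" .
qed

lemma linear_curvature:
  assumes "x \<in> S"
  shows "linear (\<lambda>u. R x u v w)"
  using linear_frechet_derivative[OF differentiable_\<Gamma>[OF assms], of v w]
    linear_D\<Gamma>2[OF assms, where u = v and w = w]
  by (simp add: linear_iff curvature_at_eq[OF assms] \<Gamma>_simps[OF assms] algebra_simps)

lemma curvature_skew: "x \<in> S \<Longrightarrow> R x u v w = - R x v u w"
  by (simp add: curvature_at_eq)

text \<open>The function g(w,z), with constant w and z, is differentiated along \<open>v\<close> and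
  then \<open>u\<close> by metric compatibility. Exchanging \<open>u\<close> and \<open>v\<close>
  changes nothing by Schwarz, and the products of two first covariant derivatives cancel; the rest
  says that g(R(u,v)w,z) + g(w,R(u,v)z) = 0.\<close>

lemma curvature_skew_metric:
  assumes "x \<in> S"
  shows "g x (R x u v w) z = - g x (R x u v z) w"
proof -
  have D2: "dderiv (\<lambda>y. Dg y v w z) x u =
    g x (D\<Gamma> x u v w + \<Gamma> x u (\<Gamma> x v w)) z + g x (\<Gamma> x v w) (\<Gamma> x u z)
    + (g x (\<Gamma> x u w) (\<Gamma> x v z) + g x w (D\<Gamma> x u v z + \<Gamma> x u (\<Gamma> x v z)))" for u v
  proof -
    have 1: "((\<lambda>y. \<Gamma> y v w) has_derivative (\<lambda>a. D\<Gamma> x a v w)) (at x)" for v w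
      by (rule dderiv_works[OF differentiable_\<Gamma>[OF assms]])
    have "dderiv (\<lambda>y. Dg y v w z) x u = dderiv (\<lambda>y. g y (\<Gamma> y v w) z + g y w (\<Gamma> y v z)) x u"
      by (rule dderiv_cong[OF open_S assms]) (rule metric_compatible)
    also have "\<dots> = g x (D\<Gamma> x u v w + \<Gamma> x u (\<Gamma> x v w)) z + g x (\<Gamma> x v w) (0 + \<Gamma> x u z)
      + (g x (0 + \<Gamma> x u w) (\<Gamma> x v z) + g x w (D\<Gamma> x u v z + \<Gamma> x u (\<Gamma> x v z)))"
      by (rule dderivI)
        (intro has_derivative_add has_derivative_metric assms 1 has_derivative_const)
    finally show ?thesis by simp
  qed
  show ?thesis
    using dderiv_dderiv_commute[OF open_S assms Ck2_g, where u = v and v = u, of w z]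
    unfolding D2 curvature_at_eq[OF assms]
    by (simp add: g_simps[OF assms] sym_g[OF assms, of w] algebra_simps)
qed

end

section \<open>Einstein metrics in dimension three\<close>

text \<open>An alternating form depends only on the bivector of its arguments, and the 2x2 minors
  are the coordinates of that bivector.\<close>

lemma alternating_expand:
  fixes B :: "'a::real_vector \<Rightarrow> 'a \<Rightarrow> real"
  assumes lin: "\<And>v. linear (\<lambda>u. B u v)" and alt: "\<And>u v. B u v = - B v u"
  shows "B (a1 *\<^sub>R e1 + a2 *\<^sub>R e2 + a3 *\<^sub>R e3) (b1 *\<^sub>R e1 + b2 *\<^sub>R e2 + b3 *\<^sub>R e3)
    = (a1 * b2 - a2 * b1) * B e1 e2 + (a1 * b3 - a3 * b1) * B e1 e3 + (a2 * b3 - a3 * b2) * B e2 e3"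
proof -
  have 1: "B (u + u') v = B u v + B u' v" "B (c *\<^sub>R u) v = c * B u v" for u u' v c
    using lin[of v] by (simp_all add: linear_iff)
  have 2: "B v (u + u') = B v u + B v u'" "B v (c *\<^sub>R u) = c * B v u" for u u' v c
    using 1[where v = v] alt[of v] by simp_all
  have 3: "B u u = 0" for u
    using alt[of u u] by simp
  show ?thesis
    by (simp add: 1 2 3 alt[of e2 e1] alt[of e3 e1] alt[of e3 e2] algebra_simps)
qed

text \<open>The signs are variables, so that all signatures are treated together; each sign is its
  own inverse.\<close>

locale orthonormal_frame =
  fixes G :: "real^3 \<Rightarrow> real^3 \<Rightarrow> real" and e1 e2 e3 :: "real^3" and s1 s2 s3 :: real
  assumes bilinear_G: "bilinear G"
    and sym_G: "G u v = G v u"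
    and norms: "G e1 e1 = s1" "G e2 e2 = s2" "G e3 e3 = s3"
    and orthogonal: "G e1 e2 = 0" "G e1 e3 = 0" "G e2 e3 = 0"
    and signs: "s1 * s1 = 1" "s2 * s2 = 1" "s3 * s3 = 1"
begin

lemmas G_simps =
  bilinear_ladd[OF bilinear_G] bilinear_radd[OF bilinear_G]
  bilinear_lmul[OF bilinear_G] bilinear_rmul[OF bilinear_G]

lemma orthogonal': "G e2 e1 = 0" "G e3 e1 = 0" "G e3 e2 = 0"
  using orthogonal sym_G by metis+

lemmas frame_simps = norms orthogonal orthogonal'

lemma frame_expansion:
  "u = (s1 * G u e1) *\<^sub>R e1 + (s2 * G u e2) *\<^sub>R e2 + (s3 * G u e3) *\<^sub>R e3"
proof -
  \<comment> \<open>\<open>T\<close> rebuilds a vector from its coordinates. Pairing with the frame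
    reads the coordinates back, so \<open>T\<close> is injective and, by dimension,
    surjective.\<close>
  define T :: "real^3 \<Rightarrow> real^3" where "T = (\<lambda>c. c $ 1 *\<^sub>R e1 + c $ 2 *\<^sub>R e2 + c $ 3 *\<^sub>R e3)"
  have T: "G (T c) e1 = s1 * c $ 1" "G (T c) e2 = s2 * c $ 2" "G (T c) e3 = s3 * c $ 3" for c
    by (simp_all add: T_def G_simps frame_simps)
  have nz: "s1 \<noteq> 0" "s2 \<noteq> 0" "s3 \<noteq> 0"
    using signs by auto
  have "linear T"
    by (auto simp: T_def linear_iff algebra_simps)
  moreover have "c = 0" if "T c = 0" for c
    using T[of c] that nz by (simp add: bilinear_lzero[OF bilinear_G] vec_eq_iff forall_3)
  ultimately have "surj T"
    by (intro linear_injective_imp_surjective) (auto simp: linear_injective_0)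
  then obtain c where c: "u = T c"
    by blast
  show ?thesis
    unfolding c T using signs by (simp add: T_def mult.assoc[symmetric])
qed

text \<open>Expand the image of each standard basis vector in the frame vectors \<open>L e1\<close>,
  \<open>L e2\<close>, \<open>L e3\<close>; summing the diagonal entries over the basis reassembles
  the products \<open>G (L e1) e1\<close> and so on.\<close>

lemma trace_frame:
  assumes "linear L"
  shows "trace (matrix L) = s1 * G (L e1) e1 + s2 * G (L e2) e2 + s3 * G (L e3) e3"
proof -
  have expand: "G u v = (\<Sum>k\<in>UNIV. u $ k * G (axis k 1) v)" for u v
  proof -
    have "linear (\<lambda>u. G u v)"
      using bilinear_G by (simp add: bilinear_def)
    then have "G (\<Sum>k\<in>UNIV. u $ k *\<^sub>R axis k 1) v = (\<Sum>k\<in>UNIV. u $ k * G (axis k 1) v)"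
      by (simp add: linear_sum[of "\<lambda>u. G u v"] G_simps)
    then show ?thesis
      using basis_expansion[of u] by (simp add: scalar_mult_eq_scaleR)
  qed
  have "L u = (s1 * G u e1) *\<^sub>R L e1 + (s2 * G u e2) *\<^sub>R L e2 + (s3 * G u e3) *\<^sub>R L e3" for u
  proof -
    have lin: "L (c1 *\<^sub>R e1 + c2 *\<^sub>R e2 + c3 *\<^sub>R e3) = c1 *\<^sub>R L e1 + c2 *\<^sub>R L e2 + c3 *\<^sub>R L e3" for c1 c2 c3
      using assms by (simp add: linear_iff)
    then show ?thesis
      by (subst frame_expansion[of u]) (rule lin)
  qed
  from this[of "axis _ 1"] have "trace (matrix L) = (\<Sum>k\<in>UNIV. s1 * (L e1 $ k * G (axis k 1) e1)
      + s2 * (L e2 $ k * G (axis k 1) e2) + s3 * (L e3 $ k * G (axis k 1) e3))"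
    by (simp add: trace_def matrix_def algebra_simps)
  then show ?thesis
    by (simp add: expand[of "L _"] sum.distrib sum_distrib_left)
qed

text \<open>In dimension three \<open>R\<close> is a bilinear form on the three-dimensional space of bivectors, and its
  nine entries are determined by the nine components of the Ricci tensor.\<close>

lemma einstein_constant_curvature:
  fixes R :: "real^3 \<Rightarrow> real^3 \<Rightarrow> real^3 \<Rightarrow> real^3"
  assumes lin: "\<And>v w. linear (\<lambda>u. R u v w)"
    and skew: "\<And>u v w. R u v w = - R v u w"
    and skew_G: "\<And>u v w z. G (R u v w) z = - G (R u v z) w"
    and ricci: "\<And>v w. trace (matrix (\<lambda>u. R u v w)) = l * G v w"
  shows "G (R u v v) u = l / 2 * (G u u * G v v - (G u v)\<^sup>2)"
proof -
  define Q where "Q = (\<lambda>u v w z. G (R u v w) z)"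
  have neg: "G (- u) v = - G u v" for u v
    by (rule bilinear_lneg[OF bilinear_G])
  have alt1: "Q u v w z = - Q v u w z" for u v w z
    unfolding Q_def by (subst skew) (rule neg)
  have alt2: "Q u v w z = - Q u v z w" for u v w z
    unfolding Q_def by (rule skew_G)
  have lin1: "linear (\<lambda>u. Q u v w z)" for v w z
    using lin[of v w] by (simp add: Q_def linear_iff G_simps)
  have lin2: "linear (\<lambda>z. Q u v z w)" for u v w
  proof -
    have "linear (\<lambda>z. - G (R u v w) z)"
      by (simp add: linear_iff G_simps)
    then show ?thesis
      unfolding Q_def skew_G[of u v _ w] .
  qed
  have ric: "s1 * Q e1 v w e1 + s2 * Q e2 v w e2 + s3 * Q e3 v w e3 = l * G v w" for v w
    using ricci[of v w] trace_frame[OF lin[of v w]] by (simp add: Q_def)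
  have z: "Q u u w w' = 0" "Q w w' u u = 0" for u w w'
    using alt1[of u u w w'] alt2[of w w' u u] by auto
  have nz: "s1 \<noteq> 0" "s2 \<noteq> 0" "s3 \<noteq> 0"
    using signs by auto
  \<comment> \<open>In an off-diagonal Ricci component two of the three trace terms have a repeated
    argument in an alternating pair and vanish, so the remaining one must be zero. The six
    components yield the six entries.\<close>
  have off: "Q e1 e2 e1 e3 = 0" "Q e1 e3 e1 e2 = 0" "Q e1 e2 e2 e3 = 0" "Q e2 e3 e1 e2 = 0"
    "Q e1 e3 e2 e3 = 0" "Q e2 e3 e1 e3 = 0"
    using ric[of e2 e3] ric[of e3 e2] ric[of e1 e3] ric[of e3 e1] ric[of e1 e2] ric[of e2 e1] nz
      alt2[of e1 e2 e3 e1] alt2[of e1 e3 e2 e1] alt1[of e2 e1 e3 e2] alt2[of e2 e3 e1 e2]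
      alt2[of e1 e2 e3 e2] alt1[of e3 e1 e2 e3] alt1[of e3 e2 e1 e3]
    by (simp_all add: z frame_simps)
  \<comment> \<open>The minus sign accounts for the order of arguments in \<open>Q u v v u\<close>,
    the numerator of sectional curvature.\<close>
  define q12 q13 q23 where "q12 = - Q e1 e2 e1 e2" and "q13 = - Q e1 e3 e1 e3" and "q23 = - Q e2 e3 e2 e3"
  have ric1: "s2 * q12 + s3 * q13 = l * s1"
    using ric[of e1 e1] alt1[of e2 e1 e1 e2] alt1[of e3 e1 e1 e3]
    by (simp add: z frame_simps q12_def q13_def)
  have ric2: "s1 * q12 + s3 * q23 = l * s2"
    using ric[of e2 e2] alt2[of e1 e2 e2 e1] alt1[of e3 e2 e2 e3]
    by (simp add: z frame_simps q12_def q23_def)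
  have ric3: "s1 * q13 + s2 * q23 = l * s3"
    using ric[of e3 e3] alt2[of e1 e3 e3 e1] alt2[of e2 e3 e3 e2]
    by (simp add: z frame_simps q13_def q23_def)
  have ss: "s = 1 \<or> s = -1" if "s * s = 1" for s :: real
    using that by (simp add: square_eq_1_iff)
  \<comment> \<open>The sectional curvatures of the frame planes are \<open>s1 * s2 * q12\<close>
    and its analogues. Any two of them add up to \<open>l\<close>, hence each is
    \<open>l / 2\<close>.\<close>
  have q: "q12 = l / 2 * (s1 * s2)" "q13 = l / 2 * (s1 * s3)" "q23 = l / 2 * (s2 * s3)"
    using ric1 ric2 ric3 ss[OF signs(1)] ss[OF signs(2)] ss[OF signs(3)] by auto
  define a1 a2 a3 where "a1 = s1 * G u e1" and "a2 = s2 * G u e2" and "a3 = s3 * G u e3"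
  define b1 b2 b3 where "b1 = s1 * G v e1" and "b2 = s2 * G v e2" and "b3 = s3 * G v e3"
  have u: "u = a1 *\<^sub>R e1 + a2 *\<^sub>R e2 + a3 *\<^sub>R e3" and v: "v = b1 *\<^sub>R e1 + b2 *\<^sub>R e2 + b3 *\<^sub>R e3"
    using frame_expansion[of u] frame_expansion[of v]
    by (simp_all add: a1_def a2_def a3_def b1_def b2_def b3_def)
  have Quv: "Q u v w z = (a1 * b2 - a2 * b1) * Q e1 e2 w z + (a1 * b3 - a3 * b1) * Q e1 e3 w z
      + (a2 * b3 - a3 * b2) * Q e2 e3 w z" for w z
    unfolding u v by (rule alternating_expand[OF lin1 alt1])
  have Qvu: "Q w z v u = (b1 * a2 - b2 * a1) * Q w z e1 e2 + (b1 * a3 - b3 * a1) * Q w z e1 e3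
      + (b2 * a3 - b3 * a2) * Q w z e2 e3" for w z
    unfolding u v by (rule alternating_expand[OF lin2 alt2])
  have "Q u v v u = (a1 * b2 - a2 * b1)\<^sup>2 * q12 + (a1 * b3 - a3 * b1)\<^sup>2 * q13 + (a2 * b3 - a3 * b2)\<^sup>2 * q23"
    unfolding Quv Qvu off by (simp add: q12_def q13_def q23_def power2_eq_square algebra_simps)
  \<comment> \<open>Lagrange's identity with weights: the weighted sum of squared minors is a Gram
    determinant.\<close>
  also have "\<dots> = l / 2 * ((s1 * a1\<^sup>2 + s2 * a2\<^sup>2 + s3 * a3\<^sup>2) * (s1 * b1\<^sup>2 + s2 * b2\<^sup>2 + s3 * b3\<^sup>2)
      - (s1 * a1 * b1 + s2 * a2 * b2 + s3 * a3 * b3)\<^sup>2)"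
    unfolding q by algebra
  also have "s1 * a1\<^sup>2 + s2 * a2\<^sup>2 + s3 * a3\<^sup>2 = G u u"
    unfolding u by (simp add: G_simps frame_simps power2_eq_square algebra_simps)
  also have "s1 * b1\<^sup>2 + s2 * b2\<^sup>2 + s3 * b3\<^sup>2 = G v v"
    unfolding v by (simp add: G_simps frame_simps power2_eq_square algebra_simps)
  also have "s1 * a1 * b1 + s2 * a2 * b2 + s3 * a3 * b3 = G u v"
    unfolding u v by (simp add: G_simps frame_simps algebra_simps)
  finally show ?thesis
    by (simp add: Q_def)
qed

end

section \<open>Unit Killing fields\<close>

locale unit_Killing_on_open = metric_on_open S g for S g +
  fixes \<xi> :: "real^3 \<Rightarrow> real^3"
  assumes Ck2_\<xi>: "Ck_on 2 S \<xi>"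
    and unit_\<xi>: "x \<in> S \<Longrightarrow> g x (\<xi> x) (\<xi> x) = 1"
    and Killing_\<xi>: "x \<in> S \<Longrightarrow> lie_metric \<xi> g (\<lambda>_. u) (\<lambda>_. v) x = 0"
begin

lemmas differentiable_\<xi> = Ck_on_2_differentiable(1)[OF open_S Ck2_\<xi>]
  and differentiable_D\<xi> = Ck_on_2_differentiable(2)[OF open_S Ck2_\<xi>]

definition h :: "real^3 \<Rightarrow> real^3 \<Rightarrow> real^3" where
  "h x u = dderiv \<xi> x u + \<Gamma> x u (\<xi> x)"

lemma linear_h: "x \<in> S \<Longrightarrow> linear (h x)"
  using linear_frechet_derivative[OF differentiable_\<xi>, of x]
  by (simp add: h_def linear_iff \<Gamma>_simps algebra_simps)

text \<open>On constant fields, metric compatibility and the symmetry of \<open>\<Gamma>\<close>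
  turn the Lie derivative of the metric into g(h u,v) + g(u,h v).\<close>

lemma h_skew:
  assumes "x \<in> S"
  shows "g x (h x u) v = - g x u (h x v)"
  using Killing_\<xi>[OF assms, of u v] unfolding h_def
  by (simp add: lie_metric_def lie_bracket_def metric_compatible[OF assms] g_simps[OF assms]
      sym_\<Gamma>[OF assms, of "\<xi> x"])

lemma h_null: "x \<in> S \<Longrightarrow> g x (h x u) u = 0"
  using h_skew[of x u u] sym_g[of x u "h x u"] by simp

lemma h_orthogonal:
  assumes "x \<in> S"
  shows "g x (h x v) (\<xi> x) = 0"
proof -
  note d = dderiv_works[OF differentiable_\<xi>[OF assms]]
  have "dderiv (\<lambda>y. g y (\<xi> y) (\<xi> y)) x v = g x (h x v) (\<xi> x) + g x (\<xi> x) (h x v)"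
    unfolding h_def by (rule dderivI[OF has_derivative_metric[OF assms d d]])
  moreover have "dderiv (\<lambda>y. g y (\<xi> y) (\<xi> y)) x v = dderiv (\<lambda>y. 1) x v"
    by (rule dderiv_cong[OF open_S assms]) (rule unit_\<xi>)
  ultimately show ?thesis
    using sym_g[OF assms, of "\<xi> x"] by simp
qed

text \<open>The orbits of a unit Killing field are geodesics: skewness moves \<open>h\<close> to the
  other slot, where constancy of g(\<xi>,\<xi>) makes the product vanish.\<close>

lemma h_\<xi>: assumes "x \<in> S" shows "h x (\<xi> x) = 0"
proof (rule nondegenerate[OF assms])
  show "g x (h x (\<xi> x)) v = 0" for v
    using h_skew[OF assms, of "\<xi> x" v] h_orthogonal[OF assms, of v] sym_g[OF assms, of "\<xi> x"] by simp
qed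

text \<open>The coordinate derivative of \<open>h\<close> with a constant argument; the covariant
  derivative of \<open>h\<close> differs from it by Christoffel terms.\<close>

definition Dh :: "real^3 \<Rightarrow> real^3 \<Rightarrow> real^3 \<Rightarrow> real^3" where
  "Dh x a b = dderiv (\<lambda>y. dderiv \<xi> y b) x a + (D\<Gamma> x a b (\<xi> x) + \<Gamma> x b (dderiv \<xi> x a))"

lemma has_derivative_h:
  assumes "x \<in> S"
  shows "((\<lambda>y. h y b) has_derivative (\<lambda>a. Dh x a b)) (at x)"
  unfolding h_def Dh_def
proof (rule has_derivative_add)
  show "((\<lambda>y. dderiv \<xi> y b) has_derivative dderiv (\<lambda>y. dderiv \<xi> y b) x) (at x)"
    by (rule dderiv_works[OF differentiable_D\<xi>[OF assms]])
  show "((\<lambda>y. \<Gamma> y b (\<xi> y)) has_derivative (\<lambda>a. D\<Gamma> x a b (\<xi> x) + \<Gamma> x b (dderiv \<xi> x a))) (at x)"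
  proof (rule has_derivative_linear_apply[where B = "\<lambda>y. \<Gamma> y b" and B' = "\<lambda>a. D\<Gamma> x a b", OF open_S assms])
    show "linear (\<Gamma> y b)" if "y \<in> S" for y
      using bilinear_\<Gamma>[OF that] by (simp add: bilinear_def)
  qed (rule dderiv_works[OF differentiable_\<Gamma>[OF assms]] dderiv_works[OF differentiable_\<xi>[OF assms]])+
qed

text \<open>For constant \<open>a\<close> and \<open>b\<close> this is the commutator of covariant
  derivatives applied to \<xi>; the second coordinate derivatives of \<xi> cancel by
  Schwarz.\<close>

lemma curvature_\<xi>_right:
  assumes "x \<in> S"
  shows "R x a b (\<xi> x) = Dh x a b + \<Gamma> x a (h x b) - (Dh x b a + \<Gamma> x b (h x a))"
  using dderiv_dderiv_commute[OF open_S assms Ck2_\<xi>, of a b]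
  by (simp add: curvature_at_eq[OF assms] Dh_def h_def \<Gamma>_simps[OF assms])

text \<open>In \<open>R(a,\<xi>)\<xi> = - h(h a) - (\<nabla>\<^sub>\<xi> h) a\<close> the endomorphism \<open>\<nabla>\<^sub>\<xi> h\<close> is skew, like \<open>h\<close> itself,
  and so does not contribute to \<open>g(R(a,\<xi>)\<xi>, a)\<close>.\<close>

lemma curvature_\<xi>:
  assumes "x \<in> S"
  shows "g x (R x a (\<xi> x) (\<xi> x)) a = g x (h x a) (h x a)"
proof -
  note d = dderiv_works[OF differentiable_\<xi>[OF assms]]
  \<comment> \<open>Differentiating \<open>h y (\<xi> y) = 0\<close> along \<open>a\<close>
    expresses \<open>Dh x a (\<xi> x)\<close> through \<open>h\<close>.\<close>
  have "((\<lambda>y. h y (\<xi> y)) has_derivative (\<lambda>a. Dh x a (\<xi> x) + h x (dderiv \<xi> x a))) (at x)"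
    by (rule has_derivative_linear_apply[OF open_S assms linear_h has_derivative_h[OF assms] d])
  from dderivI[OF this, of a] have 1: "Dh x a (\<xi> x) = - h x (dderiv \<xi> x a)"
    using dderiv_cong[OF open_S assms, of "\<lambda>y. h y (\<xi> y)" "\<lambda>_. 0" a]
    by (simp add: h_\<xi> eq_neg_iff_add_eq_0)
  \<comment> \<open>Differentiating \<open>g y (h y a) a = 0\<close> along \<xi> encodes the
    skewness of the covariant derivative of \<open>h\<close> in that direction.\<close>
  have "((\<lambda>y. g y (h y a) a) has_derivative
      (\<lambda>b. g x (Dh x b a + \<Gamma> x b (h x a)) a + g x (h x a) (0 + \<Gamma> x b a))) (at x)"
    by (rule has_derivative_metric[OF assms has_derivative_h[OF assms] has_derivative_const])
  from dderivI[OF this, of "\<xi> x"]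
  have 2: "g x (Dh x (\<xi> x) a + \<Gamma> x (\<xi> x) (h x a)) a = - g x (h x a) (\<Gamma> x (\<xi> x) a)"
    using dderiv_cong[OF open_S assms, of "\<lambda>y. g y (h y a) a" "\<lambda>_. 0" "\<xi> x"]
    by (simp add: h_null)
  have "dderiv \<xi> x a = h x a - \<Gamma> x a (\<xi> x)"
    by (simp add: h_def)
  then have "g x (R x a (\<xi> x) (\<xi> x)) a
    = - g x (h x (h x a)) a + g x (h x (\<Gamma> x a (\<xi> x))) a + g x (h x a) (\<Gamma> x (\<xi> x) a)"
    using 2 by (simp add: curvature_\<xi>_right[OF assms] 1 h_\<xi>[OF assms] \<Gamma>_simps[OF assms]
        g_simps[OF assms] linear_diff[OF linear_h[OF assms]])
  also have "\<dots> = g x (h x a) (h x a)"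
    using h_skew[OF assms, of "h x a" a] h_skew[OF assms, of "\<Gamma> x a (\<xi> x)" a]
      sym_g[OF assms, of "h x a" "\<Gamma> x a (\<xi> x)"] sym_\<Gamma>[OF assms, of a "\<xi> x"] by simp
  finally show ?thesis .
qed

lemma einstein_unit_Killing:
  assumes x: "x \<in> S" and ricci: "\<And>v w. ricci g x v w = l * g x v w"
    and a: "g x a (\<xi> x) = 0" "g x a a = s" and s: "s * s = 1"
    and b: "g x b (\<xi> x) = 0" "g x a b = 0" "g x b b = - s"
  shows "l \<le> 0" and "g x (R x u v v) u = l / 2 * plane_area g x u v"
proof -
  interpret orthonormal_frame "g x" "\<xi> x" a b 1 s "- s"
  proof
    show "bilinear (g x)" by (rule bilinear_g[OF x])
    show "g x u v = g x v u" for u v by (rule sym_g[OF x])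
    show "g x (\<xi> x) a = 0" "g x (\<xi> x) b = 0"
      using a(1) b(1) sym_g[OF x] by metis+
  qed (use unit_\<xi>[OF x] a b s in auto)
  have K: "g x (R x u v v) u = l / 2 * (g x u u * g x v v - (g x u v)\<^sup>2)" for u v
    by (rule einstein_constant_curvature[OF linear_curvature[OF x] curvature_skew[OF x]
          curvature_skew_metric[OF x] ricci[unfolded ricci_def]])
  then show "g x (R x u v v) u = l / 2 * plane_area g x u v"
    by (simp add: plane_area_def)
  \<comment> \<open>The coefficient of \<open>b\<close> in the frame expansion, \<open>- s\<close>
    being the sign of \<open>b\<close>; the coefficients of \<xi> and \<open>a\<close> in
    \<open>h x a\<close> vanish.\<close>
  define \<alpha> where "\<alpha> = - s * g x (h x a) b"
  have "h x a = \<alpha> *\<^sub>R b"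
    using frame_expansion[of "h x a"] h_orthogonal[OF x, of a] h_null[OF x, of a]
    by (simp add: \<alpha>_def)
  \<comment> \<open>Both sides are g(R(a,\<xi>)\<xi>,a): once from constant curvature, where the
    plane has area \<open>s\<close>, and once as g(h a,h a) with
    \<open>g x b b = - s\<close>.\<close>
  then have "l / 2 * s = (- \<alpha>\<^sup>2) * s"
    using K[of a "\<xi> x"] curvature_\<xi>[OF x, of a] a b
    by (simp add: unit_\<xi>[OF x] G_simps power2_eq_square)
  moreover have "s \<noteq> 0"
    using s by auto
  ultimately have "l / 2 = - \<alpha>\<^sup>2"
    using mult_right_cancel by blast
  then show "l \<le> 0"
    using zero_le_power2[of \<alpha>] by linarith
qed

end

section \<open>Paracontact metric three-manifolds\<close>

context almost_paracontact_metric_3_manifold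
begin

lemma metric_on_chart:
  assumes "c \<in> A"
  shows "metric_on_open (coord_dom c) (g c)"
  using metric assms open_coord[OF assms]
  by unfold_locales (auto simp: pseudo_Riemannian_metric_def smooth_on_def)

text \<open>Compatibility with \<xi> in the second slot: its left side vanishes because
  \<open>\<phi>\<close> kills \<xi>.\<close>

lemma metric_xi:
  assumes "c \<in> A" "x \<in> coord_dom c"
  shows "g c x u (\<xi> c x) = \<eta> c x u"
proof -
  interpret metric_on_open "coord_dom c" "g c"
    by (rule metric_on_chart[OF assms(1)])
  show ?thesis
    using compatible[OF assms, of u "\<xi> c x"] assms
    by (simp add: phi_xi eta_xi g_simps)
qed

lemma smooth_xi: "c \<in> A \<Longrightarrow> smooth_on (coord_dom c) (\<xi> c)"
  using xi by (simp add: vector_field_def)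

lemma linear_eta: "c \<in> A \<Longrightarrow> x \<in> coord_dom c \<Longrightarrow> linear (\<eta> c x)"
  using eta by (simp add: one_form_def)

lemma conformal_Killing_imp_Killing:
  assumes "conformal_Killing A g \<xi>"
  shows "Killing A g \<xi>"
proof -
  obtain f where f: "\<And>c X Y x. c \<in> A \<Longrightarrow> smooth_on (coord_dom c) X \<Longrightarrow> smooth_on (coord_dom c) Y \<Longrightarrow>
      x \<in> coord_dom c \<Longrightarrow> lie_metric (\<xi> c) (g c) X Y x = f (coord_inv c x) * g c x (X x) (Y x)"
    using assms unfolding conformal_Killing_def by blast
  have "f (coord_inv c x) = 0" if c: "c \<in> A" and x: "x \<in> coord_dom c" for c x
  proof -
    interpret metric_on_open "coord_dom c" "g c"
      by (rule metric_on_chart[OF c])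
    have "dderiv (\<lambda>y. g c y (\<xi> c y) (\<xi> c y)) x v = dderiv (\<lambda>_. 1) x v" for v
      by (rule dderiv_cong[OF open_S x]) (simp add: metric_xi eta_xi c)
    then have "lie_metric (\<xi> c) (g c) (\<xi> c) (\<xi> c) x = 0"
      by (simp add: lie_metric_def lie_bracket_def g_simps[OF x])
    then show ?thesis
      using f[OF c smooth_xi smooth_xi x] by (simp add: metric_xi eta_xi c x)
  qed
  then show ?thesis
    using f xi by (simp add: Killing_def)
qed

lemma adapted_frame:
  assumes c: "c \<in> A" and x: "x \<in> coord_dom c"
  obtains a b s where "g c x a (\<xi> c x) = 0" "g c x a a = s" "s * s = 1"
    "g c x b (\<xi> c x) = 0" "g c x a b = 0" "g c x b b = - s"
proof -
  interpret metric_on_open "coord_dom c" "g c"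
    by (rule metric_on_chart[OF c])
  have "\<exists>a. \<eta> c x a = 0 \<and> g c x a a \<noteq> 0"
  \<comment> \<open>If \<open>ker \<eta>\<close> were totally null, polarisation would make each
    \<open>e\<close> in it orthogonal to all of \<open>ker \<eta>\<close>, and \<open>e\<close> is
    orthogonal to \<xi> anyway; a nonzero \<open>e\<close> then contradicts nondegeneracy.\<close>
  proof (rule ccontr)
    assume "\<not> ?thesis"
    then have null: "g c x a a = 0" if "\<eta> c x a = 0" for a
      using that by blast
    \<comment> \<open>The rank of the eigenbundle supplies a nonzero vector of
      \<open>ker \<eta>\<close>.\<close>
    have "\<not> {u. \<eta> c x u = 0 \<and> \<phi> c x u = u} \<subseteq> {0}"
      unfolding dim_eq_0[symmetric] eigenbundle_plus[OF c x] by simp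
    then obtain e where e: "\<eta> c x e = 0" "e \<noteq> 0" by blast
    have "g c x e v = 0" for v
    proof -
      define w where "w = v - \<eta> c x v *\<^sub>R \<xi> c x"
      have "\<eta> c x w = 0" "\<eta> c x (e + w) = 0"
        using linear_eta[OF c x] e
        by (simp_all add: w_def linear_add linear_diff linear_cmul eta_xi c x)
      then have "g c x e w = 0"
        using null[of e] null[of w] null[of "e + w"] e sym_g[OF x, of w e]
        by (simp add: g_simps[OF x])
      then show ?thesis
        using e by (simp add: w_def g_simps[OF x] metric_xi c x)
    qed
    then show False
      using nondegenerate[OF x] e by blast
  qed
  then obtain a0 where a0: "\<eta> c x a0 = 0" "g c x a0 a0 \<noteq> 0" by blast
  define q where "q = g c x a0 a0"
  \<comment> \<open>Normalisation up to sign; the indefinite metric may give \<open>q < 0\<close>,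
    hence the absolute value.\<close>
  define a where "a = (1 / sqrt \<bar>q\<bar>) *\<^sub>R a0"
  have a: "\<eta> c x a = 0"
    using linear_eta[OF c x] a0 by (simp add: a_def linear_cmul)
  have "g c x a a = q / (sqrt \<bar>q\<bar> * sqrt \<bar>q\<bar>)"
    by (simp add: a_def g_simps[OF x] q_def)
  then have aa: "g c x a a = sgn q"
    by (simp add: real_sgn_eq)
  show thesis
  proof
    show "g c x a (\<xi> c x) = 0" "g c x (\<phi> c x a) (\<xi> c x) = 0"
      by (simp_all add: metric_xi eta_phi c x a)
    show "g c x a a = sgn q" by (rule aa)
    show "sgn q * sgn q = 1"
      using a0 by (simp add: q_def sgn_real_def)
    \<comment> \<open>Compatibility on \<open>a\<close> and \<open>\<phi> c x a\<close>, where
      \<phi> squares to the identity, shows that the product equals its own negative.\<close>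
    show "g c x a (\<phi> c x a) = 0"
      using compatible[OF c x, of a "\<phi> c x a"] sym_g[OF x, of "\<phi> c x a" a]
      by (simp add: phi_phi eta_phi c x a)
    show "g c x (\<phi> c x a) (\<phi> c x a) = - sgn q"
      by (simp add: compatible[OF c x] a aa)
  qed
qed

lemma Killing_soliton_constant_curvature:
  assumes Killing: "Killing A g \<xi>" and soliton: "ricci_soliton A g \<xi>"
  shows "\<exists>k\<le>0. constant_sectional_curvature A g k"
proof -
  obtain l where l: "\<And>c X Y x. c \<in> A \<Longrightarrow> smooth_on (coord_dom c) X \<Longrightarrow> smooth_on (coord_dom c) Y \<Longrightarrow>
      x \<in> coord_dom c \<Longrightarrow>
      lie_metric (\<xi> c) (g c) X Y x + ricci (g c) x (X x) (Y x) = l * g c x (X x) (Y x)"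
    using soliton unfolding ricci_soliton_def by blast
  have lie: "lie_metric (\<xi> c) (g c) (\<lambda>_. u) (\<lambda>_. v) x = 0" if "c \<in> A" "x \<in> coord_dom c" for c x u v
    using Killing that smooth_on_const[of "coord_dom c"] unfolding Killing_def by blast
  have K: "l \<le> 0 \<and> (\<forall>u v. g c x (curvature_at (g c) x u v v) u = l / 2 * plane_area (g c) x u v)"
    if c: "c \<in> A" and x: "x \<in> coord_dom c" for c x
  proof -
    interpret unit_Killing_on_open "coord_dom c" "g c" "\<xi> c"
      using metric_on_chart[OF c] smooth_xi[OF c] lie[OF c]
      by (simp add: unit_Killing_on_open_def unit_Killing_on_open_axioms_def smooth_on_def
          metric_xi eta_xi c)
    have "ricci (g c) x v w = l * g c x v w" for v w
      using l[OF c smooth_on_const smooth_on_const x, of v w] lie[OF c x] by simp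
    moreover obtain a b s where "g c x a (\<xi> c x) = 0" "g c x a a = s" "s * s = 1"
      "g c x b (\<xi> c x) = 0" "g c x a b = 0" "g c x b b = - s"
      by (rule adapted_frame[OF c x])
    ultimately show ?thesis
      using einstein_unit_Killing[OF x] by blast
  qed
  show ?thesis
  \<comment> \<open>The sign of \<open>l\<close> is derived at a point of a chart. If all coordinate
    domains are empty, constant curvature is vacuous and 0 serves as the constant.\<close>
  proof (cases "\<exists>c\<in>A. coord_dom c \<noteq> {}")
    case True
    then have "l / 2 \<le> 0"
      using K by force
    moreover have "constant_sectional_curvature A g (l / 2)"
      using K by (simp add: constant_sectional_curvature_def sectional_curvature_def)
    ultimately show ?thesis by blast
  next
    case False
    then have "constant_sectional_curvature A g 0"
      by (auto simp: constant_sectional_curvature_def)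
    then show ?thesis by blast
  qed
qed

end

theorem theorem5p5:
  fixes M :: "'a topology" and A :: "'a chart set"
    and \<phi> :: "'a chart \<Rightarrow> real^3 \<Rightarrow> real^3 \<Rightarrow> real^3"
    and \<xi> :: "'a chart \<Rightarrow> real^3 \<Rightarrow> real^3"
    and \<eta> :: "'a chart \<Rightarrow> real^3 \<Rightarrow> real^3 \<Rightarrow> real"
    and g :: "'a chart \<Rightarrow> real^3 \<Rightarrow> real^3 \<Rightarrow> real^3 \<Rightarrow> real"
  assumes "normal_almost_paracontact_metric_3_manifold M A \<phi> \<xi> \<eta> g"
    and "conformal_Killing A g \<xi>"
  shows "Killing A g \<xi> \<and>
    (ricci_soliton A g \<xi> \<longrightarrow> (\<exists>k\<le>0. constant_sectional_curvature A g k))"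
proof -
  interpret normal_almost_paracontact_metric_3_manifold M A \<phi> \<xi> \<eta> g
    by (rule assms(1))
  show ?thesis
    using conformal_Killing_imp_Killing[OF assms(2)] Killing_soliton_constant_curvature by blast
qed

end
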